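(* Let $n$ be a positive integer, $p\in\mathbb{N}_0$ and $x\in\mathbb{C}$ with $x\neq p+1$ and $\binom{x+k}{k}\neq0$ for $1\le k\le n$. Then \[ \sum_{k=1}^n\frac{\binom{p+k}{k}}{\binom{x+k}{k}}H_{p+k} =\frac{p+1}{p-x+1}\,\frac{\binom{p+n+1}{n}}{\binom{x+n}{n}}\left(H_{p+n+1}-\frac{1}{p-x+1}\right)-\frac{p+1}{p-x+1}H_{p}+\frac{x}{(p-x+1)^2}. \]
   Context: $H_0=0$ and $H_m=\sum_{j=1}^m \frac1j$ for $m\ge1$. For $z\in\mathbb{C}$ and $k\in\mathbb{N}_0$, $\binom{z}{k}=\frac{z(z-1)\cdots(z-k+1)}{k!}$. *)

theory Defs
  imports "HOL-Analysis.Harmonic_Numbers"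
begin

end

theory Submission imports Defs begin

text \<open>
  Writing \<open>a k\<close> for the ratio of the two binomials and \<open>d = p - x + 1\<close>, the sum telescopes: with
  \<open>T k = a k * (p + k + 1) / d * (harm (p + k + 1) - 1 / d)\<close>, the recurrence
  \<open>a (k + 1) * (x + k + 1) = a k * (p + k + 1)\<close> gives
  \<open>T (k + 1) - T k = a (k + 1) * harm (p + k + 1)\<close>. The remaining terms of the formula
  are \<open>- T 0\<close>.
\<close>

lemma gbinomial_add_Suc:
  fixes z :: "'a :: field_char_0"
  shows "(z + of_nat (Suc n)) gchoose Suc n
    = (z + of_nat (Suc n)) / of_nat (Suc n) * ((z + of_nat n) gchoose n)"
  using gbinomial_absorption'[of "Suc n" "z + of_nat (Suc n)"] by simp

lemma gbinomial_add_Suc_lower: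
  fixes z :: "'a :: field_char_0"
  shows "(z + 1) * ((z + of_nat n + 1) gchoose n) = (z + of_nat n + 1) * ((z + of_nat n) gchoose n)"
  using gbinomial_absorb_comp[of "z + of_nat n + 1" n] by (simp add: algebra_simps)

text \<open>The boundary term keeps the product \<open>a n * of_nat (p + n + 1)\<close>, to which
  the recurrence for \<open>a\<close> applies directly. The case \<open>n = 0\<close> is allowed, so
  the induction starts at the empty sum.\<close>

lemma sum_gbinomial_ratio_harm:
  fixes n p :: nat and x :: "'a :: real_normed_field"
  assumes "x \<noteq> of_nat p + 1"
    and "\<And>k. 1 \<le> k \<Longrightarrow> k \<le> n \<Longrightarrow> (x + of_nat k) gchoose k \<noteq> 0"
  defines "d \<equiv> of_nat p - x + 1"
  defines "a \<equiv> \<lambda>k. (of_nat (p + k) gchoose k) / ((x + of_nat k) gchoose k)"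
  shows "(\<Sum>k = 1..n. a k * harm (p + k)) =
    a n * of_nat (p + n + 1) / d * (harm (p + n + 1) - 1 / d)
      - (of_nat p + 1) / d * harm p + x / d^2"
  using assms(2)
proof (induction n)
  case 0
  have d: "d \<noteq> 0" using assms(1) by (auto simp: d_def algebra_simps)
  \<comment> \<open>Once the harmonic numbers cancel, the right-hand side is
    \<open>1 / d - (of_nat p + 1 - x) / d^2\<close>, which vanishes because the numerator is
    \<open>d\<close>.\<close>
  have x: "x = of_nat p + 1 - d" by (simp add: d_def)
  have p: "of_nat p + 1 \<noteq> (0 :: 'a)"
    by (metis of_nat_Suc of_nat_neq_0 add.commute)
  have "harm (p + 1) = harm p + 1 / (of_nat p + 1 :: 'a)"
    by (simp add: harm_Suc field_simps)
  then show ?case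
    using d p unfolding x by (simp add: a_def divide_simps) (simp add: algebra_simps power2_eq_square)
next
  case (Suc n)
  define h where "h = (harm (p + n + 1) :: 'a)"
  have d: "d \<noteq> 0" using assms(1) by (auto simp: d_def algebra_simps)
  have q: "of_nat (p + n + 2) \<noteq> (0 :: 'a)"
    by (metis of_nat_eq_0_iff add_is_0 zero_neq_numeral)
  have nz: "(x + of_nat (Suc n)) gchoose Suc n \<noteq> 0" by (rule Suc.prems) auto
  \<comment> \<open>This is a factor of the nonzero binomial; the recurrence divides by it.\<close>
  then have xn: "x + of_nat (Suc n) \<noteq> 0"
    by (metis gbinomial_add_Suc div_0 mult_zero_left)
  have rec: "a n * of_nat (p + n + 1) = a (Suc n) * (x + of_nat (Suc n))"
    using xn gbinomial_add_Suc[of x n] gbinomial_add_Suc[of "of_nat p :: 'a" n]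
    by (simp add: a_def add_ac del: of_nat_Suc) simp
  have harm: "harm (p + Suc n + 1) = h + 1 / of_nat (p + n + 2)"
    by (simp add: h_def harm_Suc field_simps)
  have "(\<Sum>k = 1..Suc n. a k * harm (p + k)) =
      a n * of_nat (p + n + 1) / d * (h - 1 / d) - (of_nat p + 1) / d * harm p + x / d^2
      + a (Suc n) * h"
    using Suc by (simp add: h_def)
  also have "a n * of_nat (p + n + 1) / d * (h - 1 / d)
      = a (Suc n) * of_nat (p + n + 2) / d * (h + 1 / of_nat (p + n + 2) - 1 / d) - a (Suc n) * h"
  proof -
    have "of_nat (p + n + 2) = x + of_nat (Suc n) + d"
      by (simp add: d_def)
    \<comment> \<open>Used with \<open>A = a (Suc n)\<close>, \<open>y = x + of_nat (Suc n)\<close>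
      and \<open>w = of_nat (p + n + 2)\<close>. Replacing \<open>y\<close> by
      \<open>w = y + d\<close> adds \<open>A * (h - 1 / d)\<close>; the new harmonic term
      \<open>1 / w\<close> contributes \<open>A / d\<close>, which leaves exactly
      \<open>A * h\<close>.\<close>
    moreover have "A * y / d * (h - 1 / d) = A * w / d * (h + 1 / w - 1 / d) - A * h"
      if "w = y + d" "w \<noteq> 0" for A w y :: 'a
    proof -
      have "A * w / d * (h + 1 / w - 1 / d) = A * w / d * (h - 1 / d) + A / d"
        using that(2) by (simp add: algebra_simps add_divide_distrib diff_divide_distrib)
      moreover have "A * w / d = A * y / d + A"
        using d by (simp add: that(1) field_simps)
      ultimately show ?thesis
        by (simp only:) (simp add: algebra_simps)
    qed
    ultimately show ?thesis
      using q unfolding rec by blast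
  qed
  finally show ?case by (simp only: harm) (simp add: algebra_simps)
qed

theorem theorem2:
  fixes n p :: nat and x :: complex
  assumes "n > 0"
    and "x \<noteq> of_nat p + 1"
    and "\<And>k. 1 \<le> k \<Longrightarrow> k \<le> n \<Longrightarrow> (x + of_nat k) gchoose k \<noteq> 0"
  shows "(\<Sum>k = 1..n. (of_nat (p + k) gchoose k) / ((x + of_nat k) gchoose k) * harm (p + k)) =
    (of_nat p + 1) / (of_nat p - x + 1)
      * ((of_nat (p + n + 1) gchoose n) / ((x + of_nat n) gchoose n))
      * (harm (p + n + 1) - 1 / (of_nat p - x + 1))
    - (of_nat p + 1) / (of_nat p - x + 1) * harm p
    + x / (of_nat p - x + 1)^2"
proof -
  \<comment> \<open>This trades the factor \<open>p + n + 1\<close> of the boundary term for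
    \<open>p + 1\<close>, raising the upper index of the binomial by one.\<close>
  have "(of_nat (p + n) gchoose n) * of_nat (p + n + 1)
      = (of_nat p + 1) * (of_nat (p + n + 1) gchoose n :: complex)"
    using gbinomial_add_Suc_lower[of "of_nat p :: complex" n] by (simp add: ac_simps)
  then show ?thesis
    using sum_gbinomial_ratio_harm[OF assms(2,3)] by simp
qed

end
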